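(* Let $(X,\triangleright)$ be a quasi rack and assume that, for all $x,y\in X$, $$L^0_{L_x(y)}=L^0_xL^0_y .$$ Then the derived map $r_\triangleright:X\times X\to X\times X$, $r_\triangleright(x,y)=\left(L^0_x(y),\,L_y(x)\right)$, associated to $(X,\triangleright)$ is a quasi non-degenerate solution.
   Context: Juxtaposition of maps denotes composition, $(fg)(x)=f(g(x))$. For a map $f:X\to X$, a relative inverse of $f$ is a map $f^-:X\to X$ with $ff^-f=f$, $f^-ff^-=f^-$, $ff^-=f^-f$; it is unique if it exists, and $f^0:=ff^-=f^-f$. A (left) shelf $(X,\triangleright)$ is a set $X$ with a binary operation such that $x\triangleright(y\triangleright z)=(x\triangleright y)\triangleright(x\triangleright z)$ for all $x,y,z$; write $L_x(y)=x\triangleright y$. A quasi rack is a shelf such that every $L_x$ has a relative inverse $L_x^-$ and $L_x^0L_y=L_yL_x^0$ for all $x,y\in X$, where $L^0_x=L_xL_x^-=L_x^-L_x$. A solution is a pair $(X,r)$ with $r:X\times X\to X\times X$ satisfying $(r\times\mathrm{id}_X)(\mathrm{id}_X\times r)(r\times\mathrm{id}_X)=(\mathrm{id}_X\times r)(r\times\mathrm{id}_X)(\mathrm{id}_X\times r)$; write $r(x,y)=(\lambda_x(y),\rho_y(x))$. It is quasi left non-degenerate if every $\lambda_x$ has a relative inverse $\lambda_x^-$ and $\lambda_x^0\lambda_y=\lambda_y\lambda_x^0$ for all $x,y$; quasi right non-degenerate if every $\rho_x$ has a relative inverse $\rho_x^-$ and $\rho_x^0\rho_y=\rho_y\rho_x^0$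 for all $x,y$; quasi non-degenerate if both. *)

theory Defs imports Main begin

definition is_relative_inverse :: "('a \<Rightarrow> 'a) \<Rightarrow> ('a \<Rightarrow> 'a) \<Rightarrow> bool" where
  "is_relative_inverse f g \<longleftrightarrow> f \<circ> g \<circ> f = f \<and> g \<circ> f \<circ> g = g \<and> f \<circ> g = g \<circ> f"

lemma is_relative_inverse_unique:
  assumes f: "is_relative_inverse f g" and h: "is_relative_inverse f h"
  shows "g = h"
proof
  fix x
  have f1: "f (g (f y)) = f y" and f2: "g (f (g y)) = g y" and f3: "f (g y) = g (f y)" for y
    using f unfolding is_relative_inverse_def by (metis comp_apply)+
  have h1: "f (h (f y)) = f y" and h2: "h (f (h y)) = h y" and h3: "f (h y) = h (f y)" for y
    using h unfolding is_relative_inverse_def by (metis comp_apply)+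
  have e: "f (g y) = f (h y)" for y
    by (metis f1 f3 h1 h3)
  show "g x = h x"
    by (metis e f2 f3 h2 h3)
qed

definition has_relative_inverse :: "('a \<Rightarrow> 'a) \<Rightarrow> bool" where
  "has_relative_inverse f \<longleftrightarrow> (\<exists>g. is_relative_inverse f g)"

text \<open>The relative inverse \<open>f\<^sup>-\<close>; an unspecified map if \<open>f\<close> has no relative inverse.\<close>

definition rel_inv :: "('a \<Rightarrow> 'a) \<Rightarrow> 'a \<Rightarrow> 'a" where
  "rel_inv f = (THE g. is_relative_inverse f g)"

lemma is_relative_inverse_rel_inv:
  "has_relative_inverse f \<Longrightarrow> is_relative_inverse f (rel_inv f)"
  unfolding has_relative_inverse_def rel_inv_def
  by (metis is_relative_inverse_unique theI)

text \<open>The map \<open>f\<^sup>0 = f f\<^sup>-\<close>, which equals \<open>f\<^sup>- f\<close> whenever \<open>f\<close> has a relative inverse.\<close>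

definition rel_zero :: "('a \<Rightarrow> 'a) \<Rightarrow> 'a \<Rightarrow> 'a" where
  "rel_zero f = f \<circ> rel_inv f"

text \<open>The underlying set is the whole type \<open>'a\<close>. A binary operation \<open>L\<close> is curried, so that the
  left multiplication \<open>L\<^sub>x\<close> is the partial application \<open>L x\<close>.\<close>

definition shelf :: "('a \<Rightarrow> 'a \<Rightarrow> 'a) \<Rightarrow> bool" where
  "shelf L \<longleftrightarrow> (\<forall>x y z. L x (L y z) = L (L x y) (L x z))"

definition quasi_rack :: "('a \<Rightarrow> 'a \<Rightarrow> 'a) \<Rightarrow> bool" where
  "quasi_rack L \<longleftrightarrow> shelf L \<and> (\<forall>x. has_relative_inverse (L x)) \<and>
     (\<forall>x y. rel_zero (L x) \<circ> L y = L y \<circ> rel_zero (L x))"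

text \<open>\<open>r \<times> id\<close> and \<open>id \<times> r\<close> on triples, which are nested to the right.\<close>

definition on_first_two :: "('a \<times> 'a \<Rightarrow> 'a \<times> 'a) \<Rightarrow> 'a \<times> 'a \<times> 'a \<Rightarrow> 'a \<times> 'a \<times> 'a" where
  "on_first_two r = (\<lambda>(x, y, z). (fst (r (x, y)), snd (r (x, y)), z))"

definition on_last_two :: "('a \<times> 'a \<Rightarrow> 'a \<times> 'a) \<Rightarrow> 'a \<times> 'a \<times> 'a \<Rightarrow> 'a \<times> 'a \<times> 'a" where
  "on_last_two r = (\<lambda>(x, y, z). (x, r (y, z)))"

definition solution :: "('a \<times> 'a \<Rightarrow> 'a \<times> 'a) \<Rightarrow> bool" where
  "solution r \<longleftrightarrow>
     on_first_two r \<circ> on_last_two r \<circ> on_first_two r =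
     on_last_two r \<circ> on_first_two r \<circ> on_last_two r"

text \<open>The components in \<open>r (x, y) = (\<lambda>\<^sub>x(y), \<rho>\<^sub>y(x))\<close>.\<close>

definition lam :: "('a \<times> 'a \<Rightarrow> 'a \<times> 'a) \<Rightarrow> 'a \<Rightarrow> 'a \<Rightarrow> 'a" where
  "lam r x y = fst (r (x, y))"

definition rho :: "('a \<times> 'a \<Rightarrow> 'a \<times> 'a) \<Rightarrow> 'a \<Rightarrow> 'a \<Rightarrow> 'a" where
  "rho r y x = snd (r (x, y))"

definition quasi_left_nondegenerate :: "('a \<times> 'a \<Rightarrow> 'a \<times> 'a) \<Rightarrow> bool" where
  "quasi_left_nondegenerate r \<longleftrightarrow> (\<forall>x. has_relative_inverse (lam r x)) \<and>
     (\<forall>x y. rel_zero (lam r x) \<circ> lam r y = lam r y \<circ> rel_zero (lam r x))"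

definition quasi_right_nondegenerate :: "('a \<times> 'a \<Rightarrow> 'a \<times> 'a) \<Rightarrow> bool" where
  "quasi_right_nondegenerate r \<longleftrightarrow> (\<forall>x. has_relative_inverse (rho r x)) \<and>
     (\<forall>x y. rel_zero (rho r x) \<circ> rho r y = rho r y \<circ> rel_zero (rho r x))"

definition quasi_nondegenerate :: "('a \<times> 'a \<Rightarrow> 'a \<times> 'a) \<Rightarrow> bool" where
  "quasi_nondegenerate r \<longleftrightarrow> quasi_left_nondegenerate r \<and> quasi_right_nondegenerate r"

definition derived_map :: "('a \<Rightarrow> 'a \<Rightarrow> 'a) \<Rightarrow> 'a \<times> 'a \<Rightarrow> 'a \<times> 'a" where
  "derived_map L = (\<lambda>(x, y). (rel_zero (L x) y, L y x))"

end

theory Submission imports Defs begin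

text \<open>
  Write \<open>e\<^sub>x = L\<^sub>x\<^sup>0\<close>, so that \<open>r (x, y) = (e\<^sub>x y, L\<^sub>y x)\<close>. The second components of \<open>r\<close> are the left
  multiplications of the quasi rack, so right non-degeneracy is part of the hypothesis. The first
  components are the idempotents \<open>e\<^sub>x\<close>. An idempotent is its own relative inverse, and a map that
  commutes with \<open>f\<close> also commutes with \<open>f\<^sup>-\<close>, hence with \<open>f\<^sup>0\<close>. Since \<open>e\<^sub>x\<close> commutes with every \<open>L\<^sub>y\<close>,
  the \<open>e\<^sub>x\<close> commute with each other, which is left non-degeneracy.

  For the braid relation the obstacle is that the idempotents enter as indices: the two sides
  contain \<open>e\<close> and \<open>L\<close> at points of the form \<open>e\<^sub>x y\<close>. Two identities move them out,
  \<open>e\<^bsub>e\<^sub>x y\<^esub> = e\<^sub>x e\<^sub>y\<close> (lemma \<open>rel_zero_at_rel_zero\<close>) and \<open>L\<^bsub>e\<^sub>x y\<^esub> = e\<^sub>x L\<^sub>y\<close>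
  (lemma \<open>left_mult_at_rel_zero\<close>). They allow both sides of the braid relation to be
  rewritten, on a triple \<open>(x, y, z)\<close>, to \<open>(e\<^sub>x e\<^sub>y z, e\<^sub>x e\<^sub>y L\<^sub>z y, L\<^sub>z L\<^sub>y x)\<close>.
\<close>

lemma rel_zero_cancel:
  assumes "has_relative_inverse f"
  shows "rel_zero f y = rel_inv f (f y)"
    and "f (rel_zero f y) = f y"
    and "rel_zero f (f y) = f y"
    and "rel_zero f (rel_zero f y) = rel_zero f y"
proof -
  have "f \<circ> rel_inv f \<circ> f = f" and "f \<circ> rel_inv f = rel_inv f \<circ> f"
    using is_relative_inverse_rel_inv[OF assms] unfolding is_relative_inverse_def by auto
  then have 1: "f (rel_inv f (f y)) = f y" and 2: "f (rel_inv f y) = rel_inv f (f y)" for y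
    by (metis comp_apply)+
  have 3: "rel_inv f (f (f y)) = f y" for y
    using 1 2[of "f y"] by simp
  show "rel_zero f y = rel_inv f (f y)" "f (rel_zero f y) = f y" "rel_zero f (f y) = f y"
    "rel_zero f (rel_zero f y) = rel_zero f y"
    by (simp_all add: rel_zero_def 1 2 3)
qed

text \<open>Both \<open>f\<^sup>0 h\<close> and \<open>h f\<^sup>0\<close> equal \<open>f\<^sup>0 h f\<^sup>0\<close>: in \<open>f\<^sup>- f h = f\<^sup>- h f\<close> the last factor \<open>f\<close>
  absorbs \<open>f\<^sup>0\<close> on its right, and in \<open>h f f\<^sup>- = f h f\<^sup>-\<close> the first factor \<open>f\<close> absorbs \<open>f\<^sup>0\<close> on its
  left.\<close>

lemma rel_zero_commutes_if_commutes:
  assumes f: "has_relative_inverse f" and comm: "f \<circ> h = h \<circ> f"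
  shows "rel_zero f \<circ> h = h \<circ> rel_zero f"
proof
  fix y
  have c: "f (h y) = h (f y)" for y
    using comm by (metis comp_apply)
  have "rel_zero f (h y) = rel_zero f (h (rel_zero f y))"
    by (simp add: rel_zero_cancel(1)[OF f, of "h _"] c rel_zero_cancel(2)[OF f])
  also have "\<dots> = rel_zero f (f (h (rel_inv f y)))"
    by (simp add: c rel_zero_def)
  also have "\<dots> = h (rel_zero f y)"
    unfolding rel_zero_cancel(3)[OF f] by (simp add: c rel_zero_def)
  finally show "(rel_zero f \<circ> h) y = (h \<circ> rel_zero f) y"
    by simp
qed

lemma is_relative_inverse_idempotent:
  assumes "f \<circ> f = f"
  shows "is_relative_inverse f f"
  using assms by (simp add: is_relative_inverse_def)

lemma rel_zero_idempotent:
  assumes "f \<circ> f = f"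
  shows "rel_zero f = f"
proof -
  have f: "is_relative_inverse f f"
    using assms by (rule is_relative_inverse_idempotent)
  then have "is_relative_inverse f (rel_inv f)"
    using is_relative_inverse_rel_inv has_relative_inverse_def by blast
  then have "rel_inv f = f"
    using f by (rule is_relative_inverse_unique)
  then show ?thesis
    by (simp add: rel_zero_def assms)
qed

lemma quasi_rack_rel_zero_commute:
  assumes "quasi_rack L"
  shows "rel_zero (L x) (L y z) = L y (rel_zero (L x) z)"
    and "rel_zero (L x) (rel_zero (L y) z) = rel_zero (L y) (rel_zero (L x) z)"
proof -
  have inv: "has_relative_inverse (L y)"
    and comm: "L y \<circ> rel_zero (L x) = rel_zero (L x) \<circ> L y"
    using assms unfolding quasi_rack_def by simp_all
  show "rel_zero (L x) (L y z) = L y (rel_zero (L x) z)"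
    using comm by (metis comp_apply)
  show "rel_zero (L x) (rel_zero (L y) z) = rel_zero (L y) (rel_zero (L x) z)"
    using rel_zero_commutes_if_commutes[OF inv comm] by (metis comp_apply)
qed

text \<open>Since \<open>e\<^sub>x y = L\<^sub>x w\<close> for \<open>w = L\<^sub>x\<^sup>- y\<close>, the hypothesis on \<open>e\<close> makes \<open>e\<^bsub>e\<^sub>x y\<^esub>\<close> a left multiple of
  \<open>e\<^sub>x\<close>, so that it absorbs \<open>e\<^sub>x\<close>. Applied to \<open>L\<^sub>x (e\<^sub>x y) = L\<^sub>x y\<close>, the same hypothesis gives
  \<open>e\<^sub>x e\<^bsub>e\<^sub>x y\<^esub> = e\<^sub>x e\<^sub>y\<close>.\<close>

lemma rel_zero_at_rel_zero:
  assumes rack: "quasi_rack L"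
    and mult: "\<And>x y. rel_zero (L (L x y)) = rel_zero (L x) \<circ> rel_zero (L y)"
  shows "rel_zero (L (rel_zero (L x) y)) z = rel_zero (L x) (rel_zero (L y) z)"
proof -
  have inv: "has_relative_inverse (L x)"
    using rack unfolding quasi_rack_def by simp
  define w where "w = rel_inv (L x) y"
  have w: "rel_zero (L x) y = L x w"
    by (simp add: rel_zero_def w_def)
  have "rel_zero (L (rel_zero (L x) y)) z
      = rel_zero (L x) (rel_zero (L (rel_zero (L x) y)) z)"
    by (simp add: w mult rel_zero_cancel(4)[OF inv])
  also have "\<dots> = rel_zero (L (L x (rel_zero (L x) y))) z"
    by (simp add: mult)
  also have "\<dots> = rel_zero (L x) (rel_zero (L y) z)"
    by (simp only: rel_zero_cancel(2)[OF inv] mult comp_apply)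
  finally show ?thesis .
qed

text \<open>By self-distributivity, \<open>L\<^sub>x L\<^bsub>e\<^sub>x y\<^esub> = L\<^bsub>L\<^sub>x y\<^esub> L\<^sub>x = L\<^sub>x L\<^sub>y\<close>, and applying \<open>L\<^sub>x\<^sup>-\<close> gives
  \<open>e\<^sub>x L\<^bsub>e\<^sub>x y\<^esub> = e\<^sub>x L\<^sub>y\<close>. The factor \<open>e\<^sub>x\<close> on the left is absorbed by \<open>L\<^bsub>e\<^sub>x y\<^esub>\<close>, because
  \<open>e\<^bsub>e\<^sub>x y\<^esub> = e\<^sub>x e\<^sub>y\<close> fixes its image.\<close>

lemma left_mult_at_rel_zero:
  assumes rack: "quasi_rack L"
    and mult: "\<And>x y. rel_zero (L (L x y)) = rel_zero (L x) \<circ> rel_zero (L y)"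
  shows "L (rel_zero (L x) y) z = rel_zero (L x) (L y z)"
proof -
  have inv: "has_relative_inverse (L u)" and dist: "L u (L v w) = L (L u v) (L u w)" for u v w
    using rack unfolding quasi_rack_def shelf_def by blast+
  let ?a = "rel_zero (L x) y"
  have "L x (L ?a z) = L (L x ?a) (L x z)"
    by (rule dist)
  also have "\<dots> = L x (L y z)"
    by (simp only: rel_zero_cancel(2)[OF inv] dist[symmetric])
  finally have cancel: "rel_zero (L x) (L ?a z) = rel_zero (L x) (L y z)"
    by (simp add: rel_zero_cancel(1)[OF inv])
  have "L ?a z = rel_zero (L ?a) (L ?a z)"
    by (simp only: rel_zero_cancel(3)[OF inv])
  also have "\<dots> = rel_zero (L x) (rel_zero (L ?a) (L ?a z))"
    by (simp only: rel_zero_at_rel_zero[OF rack mult] rel_zero_cancel(4)[OF inv])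
  also have "\<dots> = rel_zero (L x) (L ?a z)"
    by (simp only: rel_zero_cancel(3)[OF inv])
  finally show ?thesis
    using cancel by simp
qed

lemma derived_map_solution:
  assumes rack: "quasi_rack L"
    and mult: "\<And>x y. rel_zero (L (L x y)) = rel_zero (L x) \<circ> rel_zero (L y)"
  shows "solution (derived_map L)"
  unfolding solution_def
proof (rule ext, clarify)
  fix x y z
  let ?e = "\<lambda>x. rel_zero (L x)"
  have inv: "has_relative_inverse (L u)" and dist: "L u (L v w) = L (L u v) (L u w)" for u v w
    using rack unfolding quasi_rack_def shelf_def by blast+
  note comm = quasi_rack_rel_zero_commute[OF rack]
  note zero = rel_zero_cancel(3,4)[OF inv]
  note e_index = rel_zero_at_rel_zero[OF rack mult]
  note L_index = left_mult_at_rel_zero[OF rack mult]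
  have first: "?e (?e x y) (?e (L y x) z) = ?e x (?e y z)"
    by (simp add: e_index mult zero comm(2)[of y x])
  have second: "L (?e (L y x) z) (?e x y) = ?e (L (?e y z) x) (L z y)"
  proof -
    have "L (?e (L y x) z) (?e x y) = ?e y (?e x (L z y))"
      by (simp add: L_index mult comm(1)[of x z, symmetric] zero)
    also have "\<dots> = ?e y (?e x (?e z (L z y)))"
      by (simp add: zero)
    also have "\<dots> = ?e (L (?e y z) x) (L z y)"
      by (simp only: mult comp_apply e_index comm(2)[of x z])
    finally show ?thesis .
  qed
  have third: "L z (L y x) = L (L z y) (L (?e y z) x)"
  proof -
    have "L (L z y) (L (?e y z) x) = ?e y (L (L z y) (L z x))"
      by (simp add: L_index comm(1))
    also have "\<dots> = L z (?e y (L y x))"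
      by (simp only: dist[symmetric] comm(1))
    finally show ?thesis
      by (simp add: zero)
  qed
  show "(on_first_two (derived_map L) \<circ> on_last_two (derived_map L) \<circ> on_first_two (derived_map L))
      (x, y, z) =
    (on_last_two (derived_map L) \<circ> on_first_two (derived_map L) \<circ> on_last_two (derived_map L))
      (x, y, z)"
    unfolding on_first_two_def on_last_two_def derived_map_def
    using first second third by simp
qed

lemma derived_map_quasi_nondegenerate:
  assumes rack: "quasi_rack L"
  shows "quasi_nondegenerate (derived_map L)"
proof -
  have lam: "lam (derived_map L) x = rel_zero (L x)"
    and rho: "rho (derived_map L) x = L x" for x
    by (simp_all add: lam_def rho_def derived_map_def fun_eq_iff)
  have idem: "rel_zero (L x) \<circ> rel_zero (L x) = rel_zero (L x)" for x
    using rack unfolding quasi_rack_def by (simp add: fun_eq_iff rel_zero_cancel(4))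
  have "rel_zero (L x) \<circ> rel_zero (L y) = rel_zero (L y) \<circ> rel_zero (L x)" for x y
    using quasi_rack_rel_zero_commute(2)[OF rack] unfolding fun_eq_iff comp_apply by blast
  then have "quasi_left_nondegenerate (derived_map L)"
    using is_relative_inverse_idempotent[OF idem] rel_zero_idempotent[OF idem]
    unfolding quasi_left_nondegenerate_def lam has_relative_inverse_def by metis
  moreover have "quasi_right_nondegenerate (derived_map L)"
    using rack unfolding quasi_right_nondegenerate_def rho quasi_rack_def by blast
  ultimately show ?thesis
    by (simp add: quasi_nondegenerate_def)
qed

theorem theorem2p15:
  fixes L :: "'a \<Rightarrow> 'a \<Rightarrow> 'a"
  assumes "quasi_rack L"
    and "\<And>x y. rel_zero (L (L x y)) = rel_zero (L x) \<circ> rel_zero (L y)"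
  shows "solution (derived_map L) \<and> quasi_nondegenerate (derived_map L)"
  using derived_map_solution[OF assms] derived_map_quasi_nondegenerate[OF assms(1)] by simp

end
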